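(* Let $V$ be a finite set of variants partitioned into semantic classes $\mathcal{C}$, let $m:V\to[0,1]$ be a score function, and let $\mathcal{X}=\Delta(V)$ be the set of platform strategies. Then the semantic-envelope metric $\mathsf{M}_{\mathrm{Env}(m)}$ is manipulation invariant.
   Context: Variants and classes. $V$ is a finite set of content variants. A published audit protocol consists of a finite relation $T_0\subseteq V\times V$, a function $A:V\times V\to\{0,1\}$, a confidence score $s(v,u)\in[0,1]$ for each pair in $T_0$, and a threshold $\rho\in[0,1]$; its edge set is $E_\rho=\{(v,u)\in T_0: A(v,u)=1 \text{ and } s(v,u)\ge\rho\}$. The set $\mathcal{C}$ of semantic classes is the set of equivalence classes of the reflexive-symmetric-transitive closure of $E_\rho$, so $\mathcal{C}$ is a partition of $V$. Write $\mathrm{cl}(v)\in\mathcal{C}$ for the class containing $v$. Strategies. The set of platform strategies is the probability simplex $\mathcal{X}=\Delta(V)=\{x\in\mathbb{R}_{\ge 0}^{V}:\sum_{v\in V}x_v=1\}$. Metric. For a score function $g:V\to[0,1]$ and $x\in\mathcal{X}$, $\mathsf{M}_g(x)=\sum_{v\in V}x_v g(v)$. Semantic-envelope lift. For $m:V\to[0,1]$, $\mathrm{Env}(m)(v)=\max\{m(u): u\in V,\ \mathrm{cl}(u)=\mathrm{cl}(v)\}$. Manipulation invariance. $\mathsf{M}_g$ is manipulation invariant if for all $x,x'\in\mathcal{X}$ such that $\sum_{v:\mathrm{cl}(v)=c}x_v=\sum_{v:\mathrm{cl}(v)=c}x'_v$ for every $c\in\mathcal{C}$, one has $\mathsf{M}_g(x)=\mathsf{M}_g(x')$.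 *)

theory Defs
  imports Complex_Main "HOL-Library.FuncSet"
begin

record 'v audit_protocol =
  cand :: "('v \<times> 'v) set"
  accept :: "'v \<times> 'v \<Rightarrow> nat"
  conf :: "'v \<times> 'v \<Rightarrow> real"
  threshold :: real

definition audit_protocol_on :: "'v set \<Rightarrow> 'v audit_protocol \<Rightarrow> bool" where
  "audit_protocol_on V P \<longleftrightarrow>
     finite (cand P) \<and> cand P \<subseteq> V \<times> V \<and>
     accept P \<in> V \<times> V \<rightarrow> {0, 1} \<and>
     conf P \<in> cand P \<rightarrow> {0..1} \<and>
     threshold P \<in> {0..1}"

definition edges :: "'v audit_protocol \<Rightarrow> ('v \<times> 'v) set" where
  "edges P = {e \<in> cand P. accept P e = 1 \<and> conf P e \<ge> threshold P}"

text \<open>The reflexive part of the closure is taken on \<open>V\<close> only, not on the whole type,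
  so that the equivalence classes partition \<open>V\<close>.\<close>

definition sem_rel :: "'v set \<Rightarrow> 'v audit_protocol \<Rightarrow> ('v \<times> 'v) set" where
  "sem_rel V P = (Id_on V \<union> edges P \<union> (edges P)\<inverse>)\<^sup>+"

definition sem_classes :: "'v set \<Rightarrow> 'v audit_protocol \<Rightarrow> 'v set set" where
  "sem_classes V P = V // sem_rel V P"

definition sem_cl :: "'v set \<Rightarrow> 'v audit_protocol \<Rightarrow> 'v \<Rightarrow> 'v set" where
  "sem_cl V P v = sem_rel V P `` {v}"

lemma equiv_sem_rel:
  assumes "audit_protocol_on V P"
  shows "equiv V (sem_rel V P)"
proof -
  let ?S = "Id_on V \<union> edges P \<union> (edges P)\<inverse>"
  have "?S \<subseteq> V \<times> V"
    using assms by (auto simp: audit_protocol_on_def edges_def)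
  then have "sem_rel V P \<subseteq> V \<times> V"
    unfolding sem_rel_def by (rule trancl_subset_Sigma)
  moreover have "refl_on V (sem_rel V P)"
    unfolding refl_on_def sem_rel_def by auto
  moreover have "sym ?S"
    by (auto simp: sym_def)
  then have "sym (sem_rel V P)"
    unfolding sem_rel_def by (rule sym_trancl)
  moreover have "trans (sem_rel V P)"
    by (simp add: sem_rel_def)
  ultimately show ?thesis
    by (auto simp: equiv_def)
qed

lemma sem_cl_eq_class_containing:
  assumes "audit_protocol_on V P" and "v \<in> V"
  shows "sem_cl V P v \<in> sem_classes V P" and "v \<in> sem_cl V P v"
    and "c \<in> sem_classes V P \<Longrightarrow> v \<in> c \<Longrightarrow> c = sem_cl V P v"
proof -
  note eq = equiv_sem_rel[OF assms(1)]
  show in_cls: "sem_cl V P v \<in> sem_classes V P"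
    using assms(2) by (simp add: sem_cl_def sem_classes_def quotientI)
  show mem: "v \<in> sem_cl V P v"
    using equiv_class_self[OF eq assms(2)] by (simp add: sem_cl_def)
  show "c \<in> sem_classes V P \<Longrightarrow> v \<in> c \<Longrightarrow> c = sem_cl V P v"
    using quotient_disj[OF eq] in_cls mem by (auto simp: sem_classes_def)
qed

text \<open>Strategies, scores and metrics are functions on the whole type of which only the values
  on \<open>V\<close> matter.\<close>

definition strategies :: "'v set \<Rightarrow> ('v \<Rightarrow> real) set" where
  "strategies V = {x. (\<forall>v\<in>V. x v \<ge> 0) \<and> (\<Sum>v\<in>V. x v) = 1}"

definition metric :: "'v set \<Rightarrow> ('v \<Rightarrow> real) \<Rightarrow> ('v \<Rightarrow> real) \<Rightarrow> real" where
  "metric V g x = (\<Sum>v\<in>V. x v * g v)"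

definition Env :: "'v set \<Rightarrow> 'v audit_protocol \<Rightarrow> ('v \<Rightarrow> real) \<Rightarrow> 'v \<Rightarrow> real" where
  "Env V P m v = Max {m u | u. u \<in> V \<and> sem_cl V P u = sem_cl V P v}"

definition manipulation_invariant ::
    "'v set \<Rightarrow> 'v audit_protocol \<Rightarrow> (('v \<Rightarrow> real) \<Rightarrow> real) \<Rightarrow> bool" where
  "manipulation_invariant V P M \<longleftrightarrow>
     (\<forall>x\<in>strategies V. \<forall>x'\<in>strategies V.
        (\<forall>c\<in>sem_classes V P.
           (\<Sum>v | v \<in> V \<and> sem_cl V P v = c. x v) = (\<Sum>v | v \<in> V \<and> sem_cl V P v = c. x' v))
        \<longrightarrow> M x = M x')"

end

theory Submission
  imports Defs
begin

text \<open>The envelope score of a variant depends only on its class. For any such score, grouping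
  the metric by classes gives a weighted sum of class masses (\<open>metric_class_function\<close>),
  and invariance compares only strategies with equal class masses.\<close>

lemma metric_class_function:
  assumes "finite V"
  shows "metric V (\<lambda>v. h (sem_cl V P v)) x =
    (\<Sum>c\<in>sem_cl V P ` V. (\<Sum>v | v \<in> V \<and> sem_cl V P v = c. x v) * h c)"
  unfolding metric_def
  \<comment> \<open>Split \<open>V\<close> into the fibres of \<open>sem_cl V P\<close>; the factor
    \<open>h c\<close> is constant on each.\<close>
  by (subst sum.image_gen[OF assms, where g = "sem_cl V P"])
    (auto simp: sum_distrib_right intro!: sum.cong)

lemma manipulation_invariant_class_function:
  assumes "finite V" and "audit_protocol_on V P"
  shows "manipulation_invariant V P (metric V (\<lambda>v. h (sem_cl V P v)))"
  unfolding manipulation_invariant_def metric_class_function[OF assms(1)]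
  \<comment> \<open>Every index in the image of \<open>V\<close> is a semantic class, so the
    equal-mass hypothesis applies to each summand.\<close>
  using sem_cl_eq_class_containing(1)[OF assms(2)] by (auto intro!: sum.cong)

theorem proposition2:
  fixes V :: "'v set" and P :: "'v audit_protocol" and m :: "'v \<Rightarrow> real"
  assumes "finite V"
    and "audit_protocol_on V P"
    and "m \<in> V \<rightarrow> {0..1}"
  shows "manipulation_invariant V P (metric V (Env V P m))"
  \<comment> \<open>The weight of a class is its largest score.\<close>
  using manipulation_invariant_class_function
    [OF assms(1,2), of "\<lambda>c. Max {m u | u. u \<in> V \<and> sem_cl V P u = c}"]
  unfolding Env_def .

end
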